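(* Let $n\ge1$ and $0\le m\le n$ be integers, let $a_j,b_{jj}\in C^1_{2\pi}$ for $j\le n$ with $a_j(x,t)\neq0$ for all $(x,t)\in[0,1]\times\mathbb{R}$, and let $p_{jk}\in C_{2\pi}(\mathbb{R})$ for $j,k\le n$. Put $x_j=0$ for $1\le j\le m$ and $x_j=1$ for $m<j\le n$. Let $C:C_{n,2\pi}\to C_{n,2\pi}$ be the operator $$(Cv)_j(x,t)=c_j(x_j,x,t)\sum_{k=1}^np_{jk}(\omega_j(x_j,x,t))\,v_k(1-x_k,\omega_j(x_j,x,t)),\qquad j\le n,$$ associated with the reflection boundary conditions $$u_j(x_j,t)=\sum_{k=m+1}^np_{jk}(t)u_k(0,t)+\sum_{k=1}^mp_{jk}(t)u_k(1,t),\qquad j\le n.$$ Define $$S_j(t)=\begin{cases} c_j(0,1,t)\sum_{k=1}^n|p_{jk}(\omega_j(0,1,t))|, & 1\le j\le m,\\ c_j(1,0,t)\sum_{k=1}^n|p_{jk}(\omega_j(1,0,t))|, & m<j\le n.\end{cases}$$ If $$\max_{j\le n}\max_{t\in\mathbb{R}}S_j(t)<1,$$ then $I-C:C_{n,2\pi}\to C_{n,2\pi}$ is bijective; in particular, the system $u=Cu$ is uniquely solvable in $C_{n,2\pi}$ (only $u=0$).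
   Context: $C_{n,2\pi}$ is the Banach space of all continuous maps $u:[0,1]\times\mathbb{R}\to\mathbb{R}^n$ that are $2\pi$-periodic in the second variable $t$, with the sup norm. $C^1_{2\pi}$ is the space of continuously differentiable functions $[0,1]\times\mathbb{R}\to\mathbb{R}$ that are $2\pi$-periodic in the second variable. $C_{2\pi}(\mathbb{R})$ is the space of continuous $2\pi$-periodic functions $\mathbb{R}\to\mathbb{R}$. For $j\le n$, $x\in[0,1]$, $t\in\mathbb{R}$, the $j$-th characteristic $\xi\in[0,1]\mapsto\omega_j(\xi,x,t)\in\mathbb{R}$ is the solution of $$\partial_\xi\omega_j(\xi,x,t)=\frac{1}{a_j(\xi,\omega_j(\xi,x,t))},\qquad \omega_j(x,x,t)=t,$$ and $$c_j(\xi,x,t)=\exp\int_x^\xi\Big(\frac{b_{jj}}{a_j}\Big)(\eta,\omega_j(\eta,x,t))\,d\eta.$$ *)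

theory Defs
  imports "HOL-Analysis.Analysis"
begin

definition strip :: "(real \<times> real) set" where
  "strip = {0..1} \<times> UNIV"

definition periodic_in_t :: "(real \<times> real \<Rightarrow> real) \<Rightarrow> bool" where
  "periodic_in_t f \<longleftrightarrow> (\<forall>x\<in>{0..1}. \<forall>t. f (x, t + 2 * pi) = f (x, t))"

(* Membership in this space and in the next one is a property of the values on the
   strip (derivatives at the edges are one-sided); values elsewhere are irrelevant. *)
definition C1_periodic :: "(real \<times> real \<Rightarrow> real) set" where
  "C1_periodic = {f. periodic_in_t f \<and>
     (\<exists>f' :: real \<times> real \<Rightarrow> (real \<times> real) \<Rightarrow>\<^sub>L real.
        (\<forall>z\<in>strip. (f has_derivative blinfun_apply (f' z)) (at z within strip)) \<and>
        continuous_on strip f')}"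

definition C_periodic_strip :: "(real \<times> real \<Rightarrow> real) set" where
  "C_periodic_strip = {f. periodic_in_t f \<and> continuous_on strip f}"

definition C_periodic :: "(real \<Rightarrow> real) set" where
  "C_periodic = {f. continuous_on UNIV f \<and> (\<forall>t. f (t + 2 * pi) = f t)}"

(* A map from the strip to R^n is represented by its component functions, indexed by
   1, ..., n. Requiring the value 0 at all other arguments makes this representation
   unique, so that equality of representatives is equality of maps on the strip. *)
definition C_space :: "nat \<Rightarrow> (nat \<Rightarrow> real \<times> real \<Rightarrow> real) set" where
  "C_space n = {u. (\<forall>j\<in>{1..n}. u j \<in> C_periodic_strip) \<and>
     (\<forall>j z. j \<notin> {1..n} \<or> z \<notin> strip \<longrightarrow> u j z = 0)}"

definition is_characteristic ::
  "(real \<times> real \<Rightarrow> real) \<Rightarrow> real \<Rightarrow> real \<Rightarrow> (real \<Rightarrow> real) \<Rightarrow> bool" where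
  "is_characteristic a x t y \<longleftrightarrow> y x = t \<and>
     (\<forall>\<xi>\<in>{0..1}. (y has_real_derivative 1 / a (\<xi>, y \<xi>)) (at \<xi> within {0..1}))"

(* Solutions are determined on [0,1] only, so the value at xi is what is unique. *)
definition \<omega> :: "(real \<times> real \<Rightarrow> real) \<Rightarrow> real \<Rightarrow> real \<Rightarrow> real \<Rightarrow> real" where
  "\<omega> a \<xi> x t = (THE \<tau>. \<exists>y. is_characteristic a x t y \<and> \<tau> = y \<xi>)"

(* The interval integral is oriented: it changes sign when xi < x. *)
definition char_coeff ::
  "(real \<times> real \<Rightarrow> real) \<Rightarrow> (real \<times> real \<Rightarrow> real) \<Rightarrow> real \<Rightarrow> real \<Rightarrow> real \<Rightarrow> real" where
  "char_coeff a b \<xi> x t =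
     exp (LBINT \<eta>=x..\<xi>. b (\<eta>, \<omega> a \<eta> x t) / a (\<eta>, \<omega> a \<eta> x t))"

definition bdry :: "nat \<Rightarrow> nat \<Rightarrow> real" where
  "bdry m j = (if j \<le> m then 0 else 1)"

(* Here and below, b j stands for the diagonal coefficient b_jj. *)
definition C_op ::
  "nat \<Rightarrow> nat \<Rightarrow> (nat \<Rightarrow> real \<times> real \<Rightarrow> real) \<Rightarrow> (nat \<Rightarrow> real \<times> real \<Rightarrow> real) \<Rightarrow>
   (nat \<Rightarrow> nat \<Rightarrow> real \<Rightarrow> real) \<Rightarrow>
   (nat \<Rightarrow> real \<times> real \<Rightarrow> real) \<Rightarrow> (nat \<Rightarrow> real \<times> real \<Rightarrow> real)" where
  "C_op n m a b p v = (\<lambda>j (x, t).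
     if j \<in> {1..n} \<and> (x, t) \<in> strip then
       char_coeff (a j) (b j) (bdry m j) x t *
       (\<Sum>k=1..n. p j k (\<omega> (a j) (bdry m j) x t) *
          v k (1 - bdry m k, \<omega> (a j) (bdry m j) x t))
     else 0)"

definition S ::
  "nat \<Rightarrow> nat \<Rightarrow> (nat \<Rightarrow> real \<times> real \<Rightarrow> real) \<Rightarrow> (nat \<Rightarrow> real \<times> real \<Rightarrow> real) \<Rightarrow>
   (nat \<Rightarrow> nat \<Rightarrow> real \<Rightarrow> real) \<Rightarrow> nat \<Rightarrow> real \<Rightarrow> real" where
  "S n m a b p j t =
     (if j \<le> m
      then char_coeff (a j) (b j) 0 1 t * (\<Sum>k=1..n. \<bar>p j k (\<omega> (a j) 0 1 t)\<bar>)
      else char_coeff (a j) (b j) 1 0 t * (\<Sum>k=1..n. \<bar>p j k (\<omega> (a j) 1 0 t)\<bar>))"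

(* Each S j is continuous and periodic, so the supremum over t is an attained maximum.
   (The operator Max is meaningful only on finite sets.) *)
definition max_S ::
  "nat \<Rightarrow> nat \<Rightarrow> (nat \<Rightarrow> real \<times> real \<Rightarrow> real) \<Rightarrow> (nat \<Rightarrow> real \<times> real \<Rightarrow> real) \<Rightarrow>
   (nat \<Rightarrow> nat \<Rightarrow> real \<Rightarrow> real) \<Rightarrow> real" where
  "max_S n m a b p = (MAX j\<in>{1..n}. SUP t. S n m a b p j t)"

end

(* Values at the outgoing ends x = 1 - x_j are all that (Cv) depends on, so u = Cu + g
   reduces to a fixed-point equation for these traces alone. On bounded traces its linear
   part has sup-norm at most max S < 1, and Banach's theorem gives a unique trace w;
   it is periodic because its shift by 2 pi solves the same equation. Then u is g plus
   the reflection of w.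

   The characteristics and their joint continuous dependence on (xi, x, t) come from one
   contraction on bounded continuous functions of all three variables, for the unknown
   exp(-2 L |xi - x|) (omega(xi, x, t) - t), L being a Lipschitz constant of 1/a in t:
   the weight makes the Picard operator a contraction with constant 1/2. *)
theory Submission
  imports Defs "HOL-Probability.Discrete_Topology"
begin

section \<open>Interval integrals with moving endpoints\<close>

lemma antiderivative_exists:
  fixes f :: "real \<Rightarrow> real"
  assumes "continuous_on UNIV f"
  obtains H where "\<And>x. (H has_real_derivative f x) (at x)"
proof -
  have "\<exists>F. \<forall>x::real. -\<infinity> < ereal x \<longrightarrow> ereal x < \<infinity> \<longrightarrow> (F has_vector_derivative f x) (at x)"
    by (rule einterval_antiderivative)
      (use assms in \<open>auto simp: continuous_on_eq_continuous_at\<close>)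
  then show ?thesis
    using that by (auto simp: has_real_derivative_iff_has_vector_derivative)
qed

lemma interval_integral_antiderivative:
  fixes f H :: "real \<Rightarrow> real"
  assumes "continuous_on UNIV f" "\<And>x. (H has_real_derivative f x) (at x)"
  shows "(LBINT \<eta>=x..\<xi>. f \<eta>) = H \<xi> - H x"
  by (rule interval_integral_FTC_finite)
    (use assms in \<open>auto simp flip: has_real_derivative_iff_has_vector_derivative
       intro: continuous_on_subset has_field_derivative_at_within\<close>)

text \<open>The substitution \<eta> = x + s (\<xi> - x) carries the oriented integral to the fixed
  interval [0,1]. Both orders of x and \<xi> are covered at once, because the sign sits in the
  factor \<xi> - x.\<close>

lemma interval_integral_rescale:
  fixes f :: "real \<Rightarrow> real"
  assumes f: "continuous_on UNIV f"
  shows "((\<lambda>s. (\<xi> - x) * f (x + s * (\<xi> - x))) has_integral (LBINT \<eta>=x..\<xi>. f \<eta>)) {0..1}"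
proof -
  obtain H where H: "\<And>x. (H has_real_derivative f x) (at x)"
    using antiderivative_exists[OF f] by blast
  have "((\<lambda>s. H (x + s * (\<xi> - x))) has_real_derivative (\<xi> - x) * f (x + s * (\<xi> - x))) (at s)" for s
    by (rule DERIV_cong[OF DERIV_chain2[OF H]]) (auto intro!: derivative_eq_intros)
  then have "((\<lambda>s. (\<xi> - x) * f (x + s * (\<xi> - x))) has_integral
      (H (x + 1 * (\<xi> - x)) - H (x + 0 * (\<xi> - x)))) {0..1}"
    by (intro fundamental_theorem_of_calculus)
      (auto simp flip: has_real_derivative_iff_has_vector_derivative
        intro: has_field_derivative_at_within)
  then show ?thesis
    by (simp add: interval_integral_antiderivative[OF f H])
qed

text \<open>Integrating an exponential of rate L gains a factor 1/L. This gain is what makes the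
  weighted Picard operator below a contraction without restricting the length of the
  interval.\<close>

lemma interval_integral_exp_bound:
  fixes f :: "real \<Rightarrow> real"
  assumes f: "continuous_on UNIV f" and "L > 0"
    and bound: "\<And>\<eta>. \<bar>f \<eta>\<bar> \<le> K * exp (L * \<bar>\<eta> - x\<bar>)"
  shows "\<bar>LBINT \<eta>=x..\<xi>. f \<eta>\<bar> \<le> K / L * exp (L * \<bar>\<xi> - x\<bar>)"
proof -
  let ?d = "\<bar>\<xi> - x\<bar>"
  have "K \<ge> 0"
    using bound[of x] abs_ge_zero[of "f x"] by simp
  \<comment> \<open>The dominating function is integrated exactly, with antiderivative
    \<open>K / L * exp (L * (s * ?d))\<close>. The value at s = 0 is nonnegative and is dropped at
    the end.\<close>
  have "((\<lambda>s. ?d * (K * exp (L * (s * ?d)))) has_integral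
      (K / L * exp (L * (1 * ?d)) - K / L * exp (L * (0 * ?d)))) {0..1}"
    using \<open>L > 0\<close> by (intro fundamental_theorem_of_calculus)
      (auto simp flip: has_real_derivative_iff_has_vector_derivative
        intro!: derivative_eq_intros)
  moreover have "norm ((\<xi> - x) * f (x + s * (\<xi> - x))) \<le> ?d * (K * exp (L * (s * ?d)))"
    if "s \<in> {0..1}" for s
    using bound[of "x + s * (\<xi> - x)"] that by (auto simp: abs_mult intro!: mult_left_mono)
  ultimately have "norm (LBINT \<eta>=x..\<xi>. f \<eta>) \<le> K / L * exp (L * (1 * ?d)) - K / L * exp (L * (0 * ?d))"
    using interval_integral_rescale[OF f, of \<xi> x]
    by (metis (no_types, lifting) has_integral_integrable_integral integral_norm_bound_integral)
  then show ?thesis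
    using \<open>K \<ge> 0\<close> \<open>L > 0\<close> by (simp add: divide_nonneg_pos) (smt (verit) divide_nonneg_pos)
qed

text \<open>After rescaling, the endpoints have become parameters of the integrand, so continuity of
  parameter integrals over the compact interval [0,1] applies.\<close>

lemma continuous_on_interval_integral_param:
  fixes f :: "real \<Rightarrow> 'p::topological_space \<Rightarrow> real"
  assumes f: "continuous_on UNIV (\<lambda>(\<eta>, p). f \<eta> p)"
  shows "continuous_on UNIV (\<lambda>(x, \<xi>, p). LBINT \<eta>=ereal x..ereal \<xi>. f \<eta> p)"
proof -
  have "continuous_on (UNIV \<times> cbox 0 1)
      (\<lambda>((x, \<xi>, p), s). (\<xi> - x) * f (x + s * (\<xi> - x)) p)"
    unfolding case_prod_unfold
    by (intro continuous_intros
        continuous_on_compose2[OF f, of _ "\<lambda>z. (_ z, _ z)", unfolded case_prod_conv]) auto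
  then have "continuous_on UNIV
      (\<lambda>z. integral (cbox 0 1) (\<lambda>s. (\<lambda>(x, \<xi>, p) s. (\<xi> - x) * f (x + s * (\<xi> - x)) p) z s))"
    by (intro integral_continuous_on_param) (simp add: case_prod_unfold)
  moreover have "(LBINT \<eta>=ereal x..ereal \<xi>. f \<eta> p) =
      integral (cbox 0 1) (\<lambda>s. (\<xi> - x) * f (x + s * (\<xi> - x)) p)" for x \<xi> p
  proof -
    have "continuous_on UNIV (\<lambda>\<eta>. f \<eta> p)"
      by (rule continuous_on_compose2[OF f, of _ "\<lambda>\<eta>. (\<eta>, p)", unfolded case_prod_conv])
        (auto intro!: continuous_intros)
    from interval_integral_rescale[OF this, of \<xi> x] show ?thesis
      unfolding box_real by (rule integral_unique[symmetric])
  qed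
  ultimately show ?thesis
    by (simp add: case_prod_unfold)
qed

section \<open>Flows of globally Lipschitz equations\<close>

lemma lipschitz_flow_exists:
  fixes F :: "real \<times> real \<Rightarrow> real"
  assumes cont: "continuous_on UNIV F"
    and bound: "\<And>z. \<bar>F z\<bar> \<le> M"
    and lipschitz: "\<And>\<eta> y y'. \<bar>F (\<eta>, y) - F (\<eta>, y')\<bar> \<le> L * \<bar>y - y'\<bar>" and "L > 0"
  shows "\<exists>\<Phi>. continuous_on UNIV (\<lambda>(\<xi>, x, t). \<Phi> \<xi> x t) \<and> (\<forall>x t. \<Phi> x x t = t) \<and>
    (\<forall>\<xi> x t. ((\<lambda>\<xi>. \<Phi> \<xi> x t) has_real_derivative F (\<xi>, \<Phi> \<xi> x t)) (at \<xi>))"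
proof -
  \<comment> \<open>\<open>y z\<close> undoes the exponential weight and recovers a candidate flow
    from the weighted unknown z. \<open>J\<close> is the integral in the Picard iteration, and
    \<open>T\<close> puts the weight back on.\<close>
  define y :: "((real \<times> real \<times> real) \<Rightarrow>\<^sub>C real) \<Rightarrow> real \<Rightarrow> real \<times> real \<Rightarrow> real"
    where "y z \<xi> = (\<lambda>(x, t). t + exp (2 * L * \<bar>\<xi> - x\<bar>) * apply_bcontfun z (\<xi>, x, t))" for z \<xi>
  define J where "J z \<xi> x t = (LBINT \<eta>=ereal x..ereal \<xi>. F (\<eta>, y z \<eta> (x, t)))" for z \<xi> x t
  define T where "T z = (\<lambda>(\<xi>, x, t). exp (- (2 * L * \<bar>\<xi> - x\<bar>)) * J z \<xi> x t)" for z
  have z_cont: "continuous_on UNIV (\<lambda>w. apply_bcontfun z (fst w, fst (snd w), snd (snd w)))" for z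
    by (simp add: prod.collapse)
  have y_cont: "continuous_on UNIV (\<lambda>(\<eta>, p). F (\<eta>, y z \<eta> p))" for z
  proof -
    have "continuous_on UNIV (\<lambda>w. (fst w, y z (fst w) (snd w)))"
      unfolding y_def case_prod_unfold by (intro continuous_intros z_cont)
    from continuous_on_compose2[OF cont this] show ?thesis
      by (simp add: case_prod_unfold)
  qed
  have y_cont1: "continuous_on UNIV (\<lambda>\<eta>. F (\<eta>, y z \<eta> p))" for z p
    by (rule continuous_on_compose2[OF y_cont[of z], of _ "\<lambda>\<eta>. (\<eta>, p)", unfolded case_prod_conv])
      (auto intro!: continuous_intros)
  have T_cont: "continuous_on UNIV (T z)" for z
  proof -
    have "continuous_on UNIV (\<lambda>w. J z (fst w) (fst (snd w)) (snd (snd w)))"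
      unfolding J_def
      using continuous_on_compose2[OF continuous_on_interval_integral_param[OF y_cont[of z]],
          of UNIV "\<lambda>(\<xi>, x, t). (x, \<xi>, (x, t))"]
      by (simp add: case_prod_unfold continuous_intros)
    then show ?thesis
      unfolding T_def case_prod_unfold by (intro continuous_intros)
  qed
  have T_bound: "norm (T z w) \<le> M / (2 * L)" for z w
  proof -
    obtain \<xi> x t where w: "w = (\<xi>, x, t)" by (cases w)
    have "M \<ge> 0" using bound[of 0] by (smt (verit))
    \<comment> \<open>The factor is at least 1, so the bound on F is only weakened. In this form the
      exponential bound applies, and the weight in \<open>T\<close> cancels the growth of
      \<open>J\<close>.\<close>
    have "\<bar>F (\<eta>, y z \<eta> (x, t))\<bar> \<le> M * exp (2 * L * \<bar>\<eta> - x\<bar>)" for \<eta>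
      using bound[of "(\<eta>, y z \<eta> (x, t))"] mult_left_mono[of 1 "exp (2 * L * \<bar>\<eta> - x\<bar>)" M] \<open>M \<ge> 0\<close> \<open>L > 0\<close>
      by simp
    then have "\<bar>J z \<xi> x t\<bar> \<le> M / (2 * L) * exp (2 * L * \<bar>\<xi> - x\<bar>)"
      unfolding J_def using \<open>L > 0\<close> by (intro interval_integral_exp_bound y_cont1) auto
    then show ?thesis
      by (simp add: w T_def abs_mult exp_minus field_simps)
  qed
  have T_bcontfun: "T z \<in> bcontfun" for z
    by (rule bcontfun_normI[OF T_cont T_bound])
  have T_lipschitz: "dist (Bcontfun (T z)) (Bcontfun (T z')) \<le> 1 / 2 * dist z z'" for z z'
  proof (rule dist_bound)
    fix w :: "real \<times> real \<times> real"
    obtain \<xi> x t where w: "w = (\<xi>, x, t)" by (cases w)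
    have "\<bar>F (\<eta>, y z \<eta> (x, t)) - F (\<eta>, y z' \<eta> (x, t))\<bar> \<le> (L * dist z z') * exp (2 * L * \<bar>\<eta> - x\<bar>)" for \<eta>
    proof -
      have "\<bar>y z \<eta> (x, t) - y z' \<eta> (x, t)\<bar> = exp (2 * L * \<bar>\<eta> - x\<bar>) * dist (apply_bcontfun z (\<eta>, x, t)) (apply_bcontfun z' (\<eta>, x, t))"
        by (simp add: y_def dist_real_def abs_mult flip: right_diff_distrib)
      also have "\<dots> \<le> exp (2 * L * \<bar>\<eta> - x\<bar>) * dist z z'"
        by (intro mult_left_mono dist_bounded) auto
      finally have "L * \<bar>y z \<eta> (x, t) - y z' \<eta> (x, t)\<bar> \<le> L * (exp (2 * L * \<bar>\<eta> - x\<bar>) * dist z z')"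
        using \<open>L > 0\<close> by (intro mult_left_mono) auto
      then show ?thesis
        using lipschitz[of \<eta> "y z \<eta> (x, t)" "y z' \<eta> (x, t)"] by (simp only: mult_ac)
    qed
    \<comment> \<open>The weight has rate 2L while F has Lipschitz constant L, so the contraction
      constant is L / (2L) = 1/2.\<close>
    then have "\<bar>LBINT \<eta>=ereal x..ereal \<xi>. F (\<eta>, y z \<eta> (x, t)) - F (\<eta>, y z' \<eta> (x, t))\<bar>
        \<le> (L * dist z z') / (2 * L) * exp (2 * L * \<bar>\<xi> - x\<bar>)"
      using \<open>L > 0\<close> by (intro interval_integral_exp_bound continuous_intros y_cont1) auto
    also have "(LBINT \<eta>=ereal x..ereal \<xi>. F (\<eta>, y z \<eta> (x, t)) - F (\<eta>, y z' \<eta> (x, t)))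
        = J z \<xi> x t - J z' \<xi> x t"
      unfolding J_def
      by (intro interval_lebesgue_integral_diff interval_integrable_isCont)
        (use y_cont1 in \<open>auto simp: continuous_on_eq_continuous_at\<close>)
    finally have "exp (- (2 * L * \<bar>\<xi> - x\<bar>)) * \<bar>J z \<xi> x t - J z' \<xi> x t\<bar> \<le> dist z z' / 2"
      using \<open>L > 0\<close> by (simp add: exp_minus field_simps)
    then show "dist (apply_bcontfun (Bcontfun (T z)) w) (apply_bcontfun (Bcontfun (T z')) w) \<le> 1 / 2 * dist z z'"
      unfolding Bcontfun_inverse[OF T_bcontfun]
      by (simp add: w T_def dist_real_def abs_mult flip: right_diff_distrib)
  qed
  obtain z where z: "Bcontfun (T z) = z"
    using banach_fix_type[of "1 / 2" "\<lambda>z. Bcontfun (T z)"] T_lipschitz by auto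
  have "apply_bcontfun z (\<xi>, x, t) = T z (\<xi>, x, t)" for \<xi> x t
    using Bcontfun_inverse[OF T_bcontfun, of z] z by simp
  then have yJ: "y z \<xi> (x, t) = t + J z \<xi> x t" for \<xi> x t
    by (simp add: y_def T_def exp_minus)
  show ?thesis
  proof (intro exI[of _ "\<lambda>\<xi> x t. y z \<xi> (x, t)"] conjI allI)
    show "continuous_on UNIV (\<lambda>(\<xi>, x, t). y z \<xi> (x, t))"
    proof -
      have "continuous_on UNIV (\<lambda>w. snd (snd w) +
          exp (2 * L * \<bar>fst w - fst (snd w)\<bar>) * apply_bcontfun z (fst w, fst (snd w), snd (snd w)))"
        by (intro continuous_intros z_cont)
      then show ?thesis
        by (simp add: y_def case_prod_unfold)
    qed
    show "y z x (x, t) = t" for x t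
      unfolding yJ by (simp add: J_def)
    show "((\<lambda>\<xi>. y z \<xi> (x, t)) has_real_derivative F (\<xi>, y z \<xi> (x, t))) (at \<xi>)" for \<xi> x t
    proof -
      obtain H where H: "\<And>\<xi>. (H has_real_derivative F (\<xi>, y z \<xi> (x, t))) (at \<xi>)"
        using antiderivative_exists[OF y_cont1] by blast
      \<comment> \<open>One antiderivative \<open>H\<close> serves for \<xi> on both sides of x, so
        the integral equation can be differentiated directly.\<close>
      have "J z \<xi> x t = H \<xi> - H x" for \<xi>
        using interval_integral_antiderivative[OF y_cont1 H] by (simp add: J_def)
      then have "(\<lambda>\<xi>. y z \<xi> (x, t)) = (\<lambda>\<xi>. t + (H \<xi> - H x))"
        by (simp add: yJ)
      then show ?thesis
        using H[of \<xi>] by (auto intro!: derivative_eq_intros)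
    qed
  qed
qed

text \<open>A Gronwall argument: the derivative \<open>D\<close> of the squared difference is at
  most 2L times that square in absolute value. The square is used because the absolute value of y -
  y' need not be differentiable at its zeros.\<close>

lemma lipschitz_ode_unique:
  fixes F :: "real \<times> real \<Rightarrow> real"
  assumes lipschitz: "\<And>\<eta> y y'. \<eta> \<in> {l..u} \<Longrightarrow> \<bar>F (\<eta>, y) - F (\<eta>, y')\<bar> \<le> L * \<bar>y - y'\<bar>"
    and y: "\<And>\<xi>. \<xi> \<in> {l..u} \<Longrightarrow> (y has_real_derivative F (\<xi>, y \<xi>)) (at \<xi> within {l..u})"
    and y': "\<And>\<xi>. \<xi> \<in> {l..u} \<Longrightarrow> (y' has_real_derivative F (\<xi>, y' \<xi>)) (at \<xi> within {l..u})"
    and "x \<in> {l..u}" "y x = y' x" "\<xi> \<in> {l..u}"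
  shows "y \<xi> = y' \<xi>"
proof -
  define D where "D \<eta> = 2 * (y \<eta> - y' \<eta>) * (F (\<eta>, y \<eta>) - F (\<eta>, y' \<eta>))" for \<eta>
  have D: "\<bar>D \<eta>\<bar> \<le> 2 * L * (y \<eta> - y' \<eta>)\<^sup>2" if "\<eta> \<in> {l..u}" for \<eta>
  proof -
    have "\<bar>D \<eta>\<bar> \<le> 2 * \<bar>y \<eta> - y' \<eta>\<bar> * (L * \<bar>y \<eta> - y' \<eta>\<bar>)"
      unfolding D_def abs_mult using lipschitz[OF that] by (intro mult_mono) auto
    also have "\<dots> = 2 * L * (y \<eta> - y' \<eta>)\<^sup>2"
      by (simp add: power2_eq_square abs_mult_self_eq)
    finally show ?thesis .
  qed
  (* exp (c * \<eta>) (y - y')\<^sup>2 decreases for c = -2L and increases for c = 2L. *)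
  have deriv: "((\<lambda>\<eta>. exp (c * \<eta>) * (y \<eta> - y' \<eta>)\<^sup>2) has_real_derivative
      exp (c * \<eta>) * (c * (y \<eta> - y' \<eta>)\<^sup>2 + D \<eta>)) (at \<eta> within {l..u})" if "\<eta> \<in> {l..u}" for c \<eta>
    using y[OF that] y'[OF that]
    by (auto simp: D_def algebra_simps intro!: derivative_eq_intros)
  have cont: "continuous_on {v..w} (\<lambda>\<eta>. exp (c * \<eta>) * (y \<eta> - y' \<eta>)\<^sup>2)"
    if "l \<le> v" "w \<le> u" for c v w
    by (rule continuous_on_subset[OF DERIV_continuous_on[OF deriv]]) (use that in auto)
  \<comment> \<open>At interior points the derivative within \<open>{l..u}\<close> is two-sided, as
    the monotonicity rules require. At the ends of the interval they ask for continuity only, which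
    is \<open>cont\<close>.\<close>
  have deriv_at: "((\<lambda>\<eta>. exp (c * \<eta>) * (y \<eta> - y' \<eta>)\<^sup>2) has_real_derivative
      exp (c * \<eta>) * (c * (y \<eta> - y' \<eta>)\<^sup>2 + D \<eta>)) (at \<eta>)" if "l < \<eta>" "\<eta> < u" for c \<eta>
    using deriv[of \<eta> c] that by (simp add: at_within_Icc_at)
  show ?thesis
  proof (cases "x \<le> \<xi>")
    case True
    have "exp (- (2 * L) * \<xi>) * (y \<xi> - y' \<xi>)\<^sup>2 \<le> exp (- (2 * L) * x) * (y x - y' x)\<^sup>2"
    proof (rule DERIV_nonpos_imp_decreasing_open[where f = "\<lambda>\<eta>. exp (- (2 * L) * \<eta>) * (y \<eta> - y' \<eta>)\<^sup>2"])
      fix \<eta> assume "x < \<eta>" "\<eta> < \<xi>"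
      then have "l < \<eta>" "\<eta> < u"
        using assms(4,6) by auto
      moreover have "- (2 * L) * (y \<eta> - y' \<eta>)\<^sup>2 + D \<eta> \<le> 0"
        using D[of \<eta>] \<open>l < \<eta>\<close> \<open>\<eta> < u\<close> by auto
      ultimately show "\<exists>d. ((\<lambda>\<eta>. exp (- (2 * L) * \<eta>) * (y \<eta> - y' \<eta>)\<^sup>2) has_real_derivative d) (at \<eta>) \<and> d \<le> 0"
        using deriv_at[of \<eta> "- (2 * L)"] by (auto simp: mult_le_0_iff intro!: exI)
    qed (use True in simp, rule cont, use assms(4,6) in auto)
    then show ?thesis
      using \<open>y x = y' x\<close> by (simp add: mult_le_0_iff)
  next
    case False
    have "exp (2 * L * \<xi>) * (y \<xi> - y' \<xi>)\<^sup>2 \<le> exp (2 * L * x) * (y x - y' x)\<^sup>2"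
    proof (rule DERIV_nonneg_imp_increasing_open[where f = "\<lambda>\<eta>. exp (2 * L * \<eta>) * (y \<eta> - y' \<eta>)\<^sup>2"])
      fix \<eta> assume "\<xi> < \<eta>" "\<eta> < x"
      then have "l < \<eta>" "\<eta> < u"
        using assms(4,6) by auto
      moreover have "2 * L * (y \<eta> - y' \<eta>)\<^sup>2 + D \<eta> \<ge> 0"
        using D[of \<eta>] \<open>l < \<eta>\<close> \<open>\<eta> < u\<close> by auto
      ultimately show "\<exists>d. ((\<lambda>\<eta>. exp (2 * L * \<eta>) * (y \<eta> - y' \<eta>)\<^sup>2) has_real_derivative d) (at \<eta>) \<and> 0 \<le> d"
        using deriv_at[of \<eta> "2 * L"] by (auto simp: mult_le_0_iff intro!: exI)
    qed (use False in simp, rule cont, use assms(4,6) in auto)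
    then show ?thesis
      using \<open>y x = y' x\<close> by (simp add: mult_le_0_iff)
  qed
qed

section \<open>Characteristics\<close>

lemma periodic_in_t_shift_int:
  assumes "periodic_in_t f" "x \<in> {0..1}"
  shows "f (x, t - of_int k * (2 * pi)) = f (x, t)"
proof -
  interpret periodic_fun_simple "\<lambda>t. f (x, t)" "2 * pi"
    using assms by unfold_locales (simp add: periodic_in_t_def)
  show ?thesis
    by (rule minus_of_int)
qed

text \<open>Subtracting a multiple of 2 pi, found by rounding down, brings t into [0, 2 pi]. On the
  resulting compact rectangle a continuous function is bounded.\<close>

lemma periodic_strip_bounded:
  assumes "f \<in> C_periodic_strip"
  obtains M where "M > 0" "\<And>x t. x \<in> {0..1} \<Longrightarrow> \<bar>f (x, t)\<bar> \<le> M"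
proof -
  have per: "periodic_in_t f" and cont: "continuous_on strip f"
    using assms by (auto simp: C_periodic_strip_def)
  have "bounded (f ` ({0..1} \<times> {0..2 * pi}))"
    by (intro compact_imp_bounded compact_continuous_image compact_Times
        continuous_on_subset[OF cont]) (auto simp: strip_def)
  then obtain M where M: "M > 0" "\<And>z. z \<in> {0..1} \<times> {0..2 * pi} \<Longrightarrow> \<bar>f z\<bar> \<le> M"
    by (auto simp: bounded_pos)
  show ?thesis
  proof (rule that[OF M(1)])
    fix x t :: real assume x: "x \<in> {0..1}"
    define k where "k = \<lfloor>t / (2 * pi)\<rfloor>"
    have "of_int k \<le> t / (2 * pi)" "t / (2 * pi) \<le> of_int k + 1"
      unfolding k_def by linarith+
    then have "t - of_int k * (2 * pi) \<in> {0..2 * pi}"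
      by (auto simp: field_simps)
    with x M(2)[of "(x, t - of_int k * (2 * pi))"] periodic_in_t_shift_int[OF per x]
    show "\<bar>f (x, t)\<bar> \<le> M"
      by simp
  qed
qed

lemma C1_periodic_subset: "C1_periodic \<subseteq> C_periodic_strip"
  unfolding C1_periodic_def C_periodic_strip_def
  using has_derivative_continuous_on by fastforce

text \<open>The partial derivative g in t is continuous and periodic, hence bounded, and a bound on
  it is a Lipschitz constant in t that is uniform in x.\<close>

lemma C1_periodic_lipschitz:
  assumes "f \<in> C1_periodic"
  obtains L where "L > 0"
    "\<And>x y y'. x \<in> {0..1} \<Longrightarrow> \<bar>f (x, y) - f (x, y')\<bar> \<le> L * \<bar>y - y'\<bar>"
proof -
  obtain f' :: "real \<times> real \<Rightarrow> (real \<times> real) \<Rightarrow>\<^sub>L real"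
    where deriv: "\<And>z. z \<in> strip \<Longrightarrow> (f has_derivative blinfun_apply (f' z)) (at z within strip)"
      and cont: "continuous_on strip f'" and per: "periodic_in_t f"
    using assms by (auto simp: C1_periodic_def)
  define g where "g z = blinfun_apply (f' z) (0, 1)" for z
  have g: "((\<lambda>t. f (x, t)) has_real_derivative g (x, t)) (at t)" if x: "x \<in> {0..1}" for x t
  proof -
    \<comment> \<open>The whole vertical line through (x, t) lies in the strip, also for x = 0 and x
      = 1. Hence the derivative within the strip yields a two-sided derivative in t.\<close>
    have "(f has_derivative blinfun_apply (f' (x, t))) (at (x, t) within (\<lambda>t. (x, t)) ` UNIV)"
      by (rule has_derivative_subset[OF deriv]) (use x in \<open>auto simp: strip_def\<close>)
    moreover have "((\<lambda>t. (x, t)) has_derivative (\<lambda>h. (0, h))) (at t)"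
      by (auto intro!: derivative_eq_intros)
    ultimately have "((\<lambda>t. f (x, t)) has_derivative (\<lambda>h. blinfun_apply (f' (x, t)) (0, h))) (at t)"
      using has_derivative_in_compose[of "\<lambda>t. (x, t)" "\<lambda>h. (0, h)" t UNIV f] by simp
    moreover have "blinfun_apply (f' (x, t)) (0, h) = g (x, t) * h" for h
      using blinfun.scaleR_right[of "f' (x, t)" h "(0, 1)"] by (simp add: g_def mult.commute)
    ultimately show ?thesis
      by (simp add: has_field_derivative_def)
  qed
  have "periodic_in_t g"
    unfolding periodic_in_t_def
  proof (intro ballI allI)
    fix x t :: real assume x: "x \<in> {0..1}"
    \<comment> \<open>Periodicity of the derivative follows from that of f: both values are the
      derivative of one and the same function at t.\<close>
    have "((\<lambda>t. f (x, t + 2 * pi)) has_real_derivative g (x, t + 2 * pi)) (at t)"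
      by (rule DERIV_shift[THEN iffD1, OF g[OF x]])
    moreover have "(\<lambda>t. f (x, t + 2 * pi)) = (\<lambda>t. f (x, t))"
      using per x by (simp add: periodic_in_t_def)
    ultimately show "g (x, t + 2 * pi) = g (x, t)"
      using g[OF x] DERIV_unique by metis
  qed
  moreover have "continuous_on strip g"
    unfolding g_def by (intro continuous_intros cont)
  ultimately obtain L where L: "L > 0" "\<And>x t. x \<in> {0..1} \<Longrightarrow> \<bar>g (x, t)\<bar> \<le> L"
    using periodic_strip_bounded[of g] by (auto simp: C_periodic_strip_def)
  show ?thesis
  proof (rule that[OF L(1)])
    fix x y y' :: real assume x: "x \<in> {0..1}"
    show "\<bar>f (x, y) - f (x, y')\<bar> \<le> L * \<bar>y - y'\<bar>"
      using field_differentiable_bound[of UNIV "\<lambda>t. f (x, t)" "\<lambda>t. g (x, t)" L y y'] g[OF x] L(2)[OF x]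
      by simp
  qed
qed

text \<open>Constant continuation beyond the ends of [0,1]. Composition with \<open>clip\<close>
  turns functions on the strip into functions on the whole plane, where the flow and integral lemmas
  apply, and keeps bounds and Lipschitz constants in t.\<close>

definition clip :: "real \<Rightarrow> real" where
  "clip x = max 0 (min 1 x)"

lemma clip_mem: "clip x \<in> {0..1}"
  by (auto simp: clip_def)

lemma clip_id: "x \<in> {0..1} \<Longrightarrow> clip x = x"
  by (auto simp: clip_def)

lemma continuous_on_clip [continuous_intros]:
  "continuous_on A f \<Longrightarrow> continuous_on A (\<lambda>x. clip (f x))"
  unfolding clip_def by (intro continuous_intros)

section \<open>Characteristics of a single nonvanishing speed\<close>

locale nonvanishing_speed =
  fixes a :: "real \<times> real \<Rightarrow> real"
  assumes C1: "a \<in> C1_periodic"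
    and nonzero: "x \<in> {0..1} \<Longrightarrow> a (x, t) \<noteq> 0"
begin

lemma inverse_speed_mem: "(\<lambda>z. 1 / a z) \<in> C_periodic_strip"
  using subsetD[OF C1_periodic_subset C1] nonzero
  by (auto simp: C_periodic_strip_def periodic_in_t_def strip_def intro!: continuous_intros)

lemma inverse_speed_lipschitz:
  obtains L where "L > 0"
    "\<And>x y y'. x \<in> {0..1} \<Longrightarrow> \<bar>1 / a (x, y) - 1 / a (x, y')\<bar> \<le> L * \<bar>y - y'\<bar>"
proof -
  obtain K where K: "K > 0"
    "\<And>x y y'. x \<in> {0..1} \<Longrightarrow> \<bar>a (x, y) - a (x, y')\<bar> \<le> K * \<bar>y - y'\<bar>"
    using C1_periodic_lipschitz[OF C1] by blast
  obtain M where M: "M > 0" "\<And>x t. x \<in> {0..1} \<Longrightarrow> \<bar>1 / a (x, t)\<bar> \<le> M"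
    using periodic_strip_bounded[OF inverse_speed_mem] by blast
  show ?thesis
  \<comment> \<open>The difference of two reciprocals is the difference of the speeds times both
    reciprocals: K bounds the first factor relative to the distance of y and y', and M bounds each
    of the other two.\<close>
  proof (rule that[of "K * M * M"])
    fix x y y' :: real assume x: "x \<in> {0..1}"
    have "\<bar>1 / a (x, y) - 1 / a (x, y')\<bar> = \<bar>a (x, y') - a (x, y)\<bar> * \<bar>1 / a (x, y)\<bar> * \<bar>1 / a (x, y')\<bar>"
      using nonzero[OF x, of y] nonzero[OF x, of y'] by (simp add: divide_simps flip: abs_mult)
    also have "\<dots> \<le> (K * \<bar>y' - y\<bar>) * M * M"
      using K M x by (intro mult_mono) auto
    finally show "\<bar>1 / a (x, y) - 1 / a (x, y')\<bar> \<le> K * M * M * \<bar>y - y'\<bar>"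
      by (simp add: mult_ac abs_minus_commute)
  qed (use K M in auto)
qed

lemma characteristic_unique:
  assumes "is_characteristic a x t y" "is_characteristic a x t y'" "x \<in> {0..1}" "\<xi> \<in> {0..1}"
  shows "y \<xi> = y' \<xi>"
proof -
  obtain L where L:
    "\<And>x v v'. x \<in> {0..1} \<Longrightarrow> \<bar>1 / a (x, v) - 1 / a (x, v')\<bar> \<le> L * \<bar>v - v'\<bar>"
    using inverse_speed_lipschitz by metis
  show ?thesis
  proof (rule lipschitz_ode_unique[where F = "\<lambda>z. 1 / a z" and L = L and l = 0 and u = 1 and x = x
        and y = y and y' = y' and \<xi> = \<xi>])
    show "\<bar>1 / a (\<eta>, v) - 1 / a (\<eta>, v')\<bar> \<le> L * \<bar>v - v'\<bar>" if "\<eta> \<in> {0..1}" for \<eta> v v'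
      using L[OF that] .
  qed (use assms in \<open>auto simp: is_characteristic_def\<close>)
qed

text \<open>By uniqueness, the definite description in \<omega> may be evaluated with any
  characteristic at hand.\<close>

lemma omega_eq:
  assumes "is_characteristic a x t y" "x \<in> {0..1}" "\<xi> \<in> {0..1}"
  shows "\<omega> a \<xi> x t = y \<xi>"
  unfolding \<omega>_def by (rule the_equality) (use assms characteristic_unique in blast)+

text \<open>With its first argument clipped, 1/a becomes bounded, continuous and Lipschitz in y on
  the whole plane. The flow of this extension satisfies the original equation on [0,1], where
  \<open>clip\<close> is the identity.\<close>

lemma characteristic_flow_exists:
  "\<exists>\<Phi>. continuous_on UNIV (\<lambda>(\<xi>, x, t). \<Phi> \<xi> x t) \<and>
     (\<forall>x t. is_characteristic a x t (\<lambda>\<xi>. \<Phi> \<xi> x t))"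
proof -
  define F where "F = (\<lambda>(\<eta>, y). 1 / a (clip \<eta>, y))"
  obtain L where L: "L > 0"
    "\<And>x y y'. x \<in> {0..1} \<Longrightarrow> \<bar>1 / a (x, y) - 1 / a (x, y')\<bar> \<le> L * \<bar>y - y'\<bar>"
    using inverse_speed_lipschitz by metis
  obtain M where M: "M > 0" "\<And>x t. x \<in> {0..1} \<Longrightarrow> \<bar>1 / a (x, t)\<bar> \<le> M"
    using periodic_strip_bounded[OF inverse_speed_mem] by blast
  have "continuous_on strip (\<lambda>z. 1 / a z)"
    using inverse_speed_mem by (simp add: C_periodic_strip_def)
  moreover have "continuous_on UNIV (\<lambda>z :: real \<times> real. (clip (fst z), snd z))"
    by (intro continuous_intros)
  ultimately have "continuous_on UNIV (\<lambda>z. 1 / a (clip (fst z), snd z))"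
    by (rule continuous_on_compose2) (use clip_mem in \<open>auto simp: strip_def\<close>)
  then have F_cont: "continuous_on UNIV F"
    by (simp add: F_def case_prod_unfold)
  have F_bound: "\<bar>F z\<bar> \<le> M" for z
    using M(2)[OF clip_mem] by (auto simp: F_def case_prod_unfold)
  have F_lipschitz: "\<bar>F (\<eta>, y) - F (\<eta>, y')\<bar> \<le> L * \<bar>y - y'\<bar>" for \<eta> y y'
    using L(2)[OF clip_mem] by (simp add: F_def)
  obtain \<Phi> where \<Phi>: "continuous_on UNIV (\<lambda>(\<xi>, x, t). \<Phi> \<xi> x t)" "\<forall>x t. \<Phi> x x t = t"
    "\<forall>\<xi> x t. ((\<lambda>\<xi>. \<Phi> \<xi> x t) has_real_derivative F (\<xi>, \<Phi> \<xi> x t)) (at \<xi>)"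
    using lipschitz_flow_exists[OF F_cont F_bound F_lipschitz L(1)] by (elim exE conjE)
  have "is_characteristic a x t (\<lambda>\<xi>. \<Phi> \<xi> x t)" for x t
    unfolding is_characteristic_def
  proof (intro conjI ballI)
    fix \<xi> :: real assume "\<xi> \<in> {0..1}"
    then show "((\<lambda>\<xi>. \<Phi> \<xi> x t) has_real_derivative 1 / a (\<xi>, \<Phi> \<xi> x t)) (at \<xi> within {0..1})"
      using has_field_derivative_at_within[OF \<Phi>(3)[rule_format, of x t \<xi>]] by (simp add: F_def clip_id)
  qed (simp add: \<Phi>(2))
  with \<Phi>(1) show ?thesis
    by (intro exI[of _ \<Phi>] conjI allI)
qed

text \<open>Since a is periodic in t, a characteristic raised by 2 pi is again a characteristic;
  uniqueness identifies it with the one through t + 2 pi.\<close>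

lemma omega_add_period:
  assumes "x \<in> {0..1}" "\<xi> \<in> {0..1}"
  shows "\<omega> a \<xi> x (t + 2 * pi) = \<omega> a \<xi> x t + 2 * pi"
proof -
  obtain \<Phi> where \<Phi>: "\<forall>x t. is_characteristic a x t (\<lambda>\<xi>. \<Phi> \<xi> x t)"
    using characteristic_flow_exists by (elim exE conjE)
  have "periodic_in_t a"
    using C1 by (simp add: C1_periodic_def)
  then have shifted: "is_characteristic a x (t + 2 * pi) (\<lambda>\<xi>. \<Phi> \<xi> x t + 2 * pi)"
    using \<Phi>[rule_format, of x t] by (auto simp: is_characteristic_def periodic_in_t_def intro!: derivative_eq_intros)
  then show ?thesis
    using omega_eq[OF shifted assms] omega_eq[OF \<Phi>[rule_format] assms] by simp
qed

text \<open>Clipping confines both arguments to [0,1], where \<omega> agrees with the jointly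
  continuous flow.\<close>

lemma continuous_on_omega_clip:
  "continuous_on UNIV (\<lambda>(\<xi>, x, t). \<omega> a (clip \<xi>) (clip x) t)"
proof -
  obtain \<Phi> where \<Phi>: "continuous_on UNIV (\<lambda>(\<xi>, x, t). \<Phi> \<xi> x t)"
    "\<forall>x t. is_characteristic a x t (\<lambda>\<xi>. \<Phi> \<xi> x t)"
    using characteristic_flow_exists by (elim exE conjE)
  have "continuous_on UNIV (\<lambda>w. \<Phi> (clip (fst w)) (clip (fst (snd w))) (snd (snd w)))"
    using continuous_on_compose2[OF \<Phi>(1), of UNIV "\<lambda>w. (clip (fst w), clip (fst (snd w)), snd (snd w))"]
    by (simp add: continuous_intros)
  then show ?thesis
    by (simp add: omega_eq[OF \<Phi>(2)[rule_format] clip_mem clip_mem] case_prod_unfold)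
qed

lemma continuous_on_omega:
  assumes "\<xi> \<in> {0..1}"
  shows "continuous_on strip (\<lambda>(x, t). \<omega> a \<xi> x t)"
proof -
  have "continuous_on strip (\<lambda>z. \<omega> a (clip \<xi>) (clip (fst z)) (snd z))"
    using continuous_on_compose2[OF continuous_on_omega_clip, of strip "\<lambda>z. (\<xi>, fst z, snd z)"]
    by (simp add: continuous_intros case_prod_unfold)
  then show ?thesis
    by (rule continuous_on_eq) (use assms in \<open>auto simp: strip_def clip_id\<close>)
qed

lemma C_periodic_comp_omega:
  assumes "\<phi> \<in> C_periodic" "\<xi> \<in> {0..1}"
  shows "(\<lambda>(x, t). \<phi> (\<omega> a \<xi> x t)) \<in> C_periodic_strip"
  using assms continuous_on_compose2[OF _ continuous_on_omega[OF assms(2)], of UNIV \<phi>]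
  by (auto simp: C_periodic_def C_periodic_strip_def periodic_in_t_def omega_add_period case_prod_unfold)

text \<open>The integration variable stays between x and \<xi>, hence in [0,1], so clipping changes
  nothing there. The new integrand is defined through values on the strip for every real
  \<eta>.\<close>

lemma char_coeff_clip:
  assumes "\<xi> \<in> {0..1}" "x \<in> {0..1}"
  shows "char_coeff a b \<xi> x t = exp (LBINT \<eta>=x..\<xi>.
    b (clip \<eta>, \<omega> a (clip \<eta>) (clip x) t) / a (clip \<eta>, \<omega> a (clip \<eta>) (clip x) t))"
proof -
  have "\<eta> \<in> {0..1}" if "\<eta> \<in> einterval (min (ereal x) (ereal \<xi>)) (max (ereal x) (ereal \<xi>))" for \<eta>
    using that assms by (auto simp: einterval_def min_def max_def split: if_splits)
  then show ?thesis
    unfolding char_coeff_def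
    by (intro arg_cong[where f = exp] interval_integral_cong) (use assms in \<open>simp add: clip_id\<close>)
qed

lemma char_coeff_mem:
  assumes b: "b \<in> C_periodic_strip" and \<xi>: "\<xi> \<in> {0..1}"
  shows "(\<lambda>(x, t). char_coeff a b \<xi> x t) \<in> C_periodic_strip"
proof -
  define f where "f \<eta> = (\<lambda>(x, t).
    b (clip \<eta>, \<omega> a (clip \<eta>) (clip x) t) / a (clip \<eta>, \<omega> a (clip \<eta>) (clip x) t))" for \<eta>
  have eq: "char_coeff a b \<xi> x t = exp (LBINT \<eta>=ereal x..ereal \<xi>. f \<eta> (x, t))" if "x \<in> {0..1}" for x t
    using char_coeff_clip[OF \<xi> that] by (simp add: f_def)
  have "periodic_in_t a" "continuous_on strip a"
    using subsetD[OF C1_periodic_subset C1] by (simp_all add: C_periodic_strip_def)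
  have "periodic_in_t b" "continuous_on strip b"
    using b by (simp_all add: C_periodic_strip_def)
  have quotient: "continuous_on strip (\<lambda>z. b z / a z)"
    using \<open>continuous_on strip a\<close> \<open>continuous_on strip b\<close> nonzero
    by (auto simp: strip_def intro!: continuous_intros)
  have "continuous_on UNIV (\<lambda>w. \<omega> a (clip (fst w)) (clip (fst (snd w))) (snd (snd w)))"
    using continuous_on_omega_clip by (simp add: case_prod_unfold)
  then have "continuous_on UNIV (\<lambda>w. (clip (fst w), \<omega> a (clip (fst w)) (clip (fst (snd w))) (snd (snd w))))"
    by (intro continuous_on_Pair continuous_on_clip continuous_on_fst continuous_on_id)
  moreover have "(\<lambda>w. (clip (fst w), \<omega> a (clip (fst w)) (clip (fst (snd w))) (snd (snd w)))) ` UNIV \<subseteq> strip"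
    using clip_mem by (auto simp: strip_def)
  ultimately have "continuous_on UNIV (\<lambda>(\<eta>, p). f \<eta> p)"
    unfolding f_def case_prod_unfold by (rule continuous_on_compose2[OF quotient])
  \<comment> \<open>The point x enters twice: as the lower endpoint and, within z, as a parameter of
    the integrand.\<close>
  from continuous_on_compose2[OF continuous_on_interval_integral_param[OF this], of strip "\<lambda>z. (fst z, \<xi>, z)"]
  have "continuous_on strip (\<lambda>z. LBINT \<eta>=ereal (fst z)..ereal \<xi>. f \<eta> z)"
    by (simp add: continuous_intros)
  then have "continuous_on strip (\<lambda>z. exp (LBINT \<eta>=ereal (fst z)..ereal \<xi>. f \<eta> z))"
    by (rule continuous_on_exp)
  then have "continuous_on strip (\<lambda>(x, t). char_coeff a b \<xi> x t)"
    by (rule continuous_on_eq) (auto simp: strip_def eq)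
  moreover have "f \<eta> (x, t + 2 * pi) = f \<eta> (x, t)" for \<eta> x t
    using \<open>periodic_in_t a\<close> \<open>periodic_in_t b\<close> clip_mem
    by (simp add: f_def omega_add_period[OF clip_mem clip_mem] periodic_in_t_def)
  ultimately show ?thesis
    by (simp add: C_periodic_strip_def periodic_in_t_def eq)
qed

end

section \<open>The reflection operator\<close>

lemma C_periodic_strip_mult:
  assumes "f \<in> C_periodic_strip" "g \<in> C_periodic_strip"
  shows "(\<lambda>z. f z * g z) \<in> C_periodic_strip"
  using assms by (auto simp: C_periodic_strip_def periodic_in_t_def intro: continuous_on_mult)

lemma C_periodic_strip_sum:
  assumes "\<And>k. k \<in> K \<Longrightarrow> f k \<in> C_periodic_strip"
  shows "(\<lambda>z. \<Sum>k\<in>K. f k z) \<in> C_periodic_strip"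
  using assms by (auto simp: C_periodic_strip_def periodic_in_t_def intro!: continuous_on_sum sum.cong)

lemma C_periodic_strip_cong:
  assumes "f \<in> C_periodic_strip" "\<And>z. z \<in> strip \<Longrightarrow> f z = g z"
  shows "g \<in> C_periodic_strip"
  using assms continuous_on_cong[of strip strip f g]
  by (auto simp: C_periodic_strip_def periodic_in_t_def strip_def)

lemma C_periodic_section:
  assumes "f \<in> C_periodic_strip" "x \<in> {0..1}"
  shows "(\<lambda>t. f (x, t)) \<in> C_periodic"
proof -
  have "continuous_on UNIV (\<lambda>t. (x, t))"
    by (intro continuous_intros)
  with assms show ?thesis
    unfolding C_periodic_strip_def C_periodic_def
    by (auto simp: periodic_in_t_def strip_def intro: continuous_on_compose2)
qed

lemma C_space_diff: "u \<in> C_space n \<Longrightarrow> v \<in> C_space n \<Longrightarrow> u - v \<in> C_space n"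
  by (auto simp: C_space_def C_periodic_strip_def periodic_in_t_def fun_diff_def intro: continuous_on_diff)

lemma C_space_add: "u \<in> C_space n \<Longrightarrow> v \<in> C_space n \<Longrightarrow> (\<lambda>j z. u j z + v j z) \<in> C_space n"
  by (auto simp: C_space_def C_periodic_strip_def periodic_in_t_def intro: continuous_on_add)

section \<open>Boundary traces as bounded continuous functions\<close>

lemma continuous_on_discrete_prod:
  fixes f :: "'a discrete \<times> 'b::topological_space \<Rightarrow> 'c::topological_space"
  assumes "\<And>j. continuous_on UNIV (\<lambda>t. f (j, t))"
  shows "continuous_on UNIV f"
proof -
  \<comment> \<open>The slices over single indices are open and cover the product, so continuity on
    each slice gives continuity everywhere.\<close>
  have "continuous_on (\<Union>j. {j} \<times> UNIV) f"
  proof (rule continuous_on_open_UN)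
    fix j :: "'a discrete"
    show "open ({j} \<times> (UNIV :: 'b set))"
      by (intro open_Times Discrete_Topology.open_discrete open_UNIV)
    have "continuous_on ({j} \<times> UNIV) (\<lambda>z. f (j, snd z))"
      by (rule continuous_on_compose2[OF assms[of j] continuous_on_snd]) (auto intro: continuous_on_id)
    then show "continuous_on ({j} \<times> UNIV) f"
      by (rule continuous_on_eq) auto
  qed
  moreover have "(\<Union>j. {j} \<times> UNIV) = (UNIV :: ('a discrete \<times> 'b) set)"
    by auto
  ultimately show ?thesis
    by simp
qed

(* Completeness of the space of bounded continuous functions is available over metric
   domains only, and nat carries no metric: hence the index type nat discrete. *)
abbreviation component ::
  "((nat discrete \<times> real) \<Rightarrow>\<^sub>C real) \<Rightarrow> nat \<Rightarrow> real \<Rightarrow> real" where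
  "component w k t \<equiv> apply_bcontfun w (discrete k, t)"

lemma bcontfun_of_components:
  fixes f :: "nat \<Rightarrow> real \<Rightarrow> real"
  assumes "\<And>j. continuous_on UNIV (f j)" "\<And>j t. \<bar>f j t\<bar> \<le> B"
  shows "(\<lambda>(j, t). f (of_discrete j) t) \<in> bcontfun"
proof (rule bcontfun_normI)
  show "continuous_on UNIV (\<lambda>(j, t). f (of_discrete j) t)"
    by (rule continuous_on_discrete_prod) (simp add: assms)
  show "norm (case z of (j, t) \<Rightarrow> f (of_discrete j) t) \<le> B" for z
    using assms(2) by (simp add: case_prod_unfold)
qed

lemma component_Bcontfun:
  fixes f :: "nat \<Rightarrow> real \<Rightarrow> real"
  assumes "\<And>j. continuous_on UNIV (f j)" "\<And>j t. \<bar>f j t\<bar> \<le> B"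
  shows "component (Bcontfun (\<lambda>(j, t). f (of_discrete j) t)) j t = f j t"
  using Bcontfun_inverse[OF bcontfun_of_components, of f B] assms
  by (simp add: discrete_inverse)

lemma component_eqI:
  assumes "\<And>j t. component w j t = component w' j t"
  shows "w = w'"
proof (rule bcontfun_eqI)
  fix z
  show "apply_bcontfun w z = apply_bcontfun w' z"
    using assms[of "of_discrete (fst z)" "snd z"] by (simp add: of_discrete_inverse)
qed

lemma continuous_on_component: "continuous_on UNIV (component w j)"
  by (rule continuous_on_compose2[OF continuous_on_apply_bcontfun[of UNIV]])
    (auto intro: continuous_intros)

lemma abs_component_le_norm: "\<bar>component w j t\<bar> \<le> norm w"
  using norm_bounded[of w] by simp

lemma bdry_mem: "bdry m j \<in> {0..1}" "1 - bdry m j \<in> {0..1}"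
  by (auto simp: bdry_def)

section \<open>The reflection map on traces\<close>

definition outgoing_trace ::
  "nat \<Rightarrow> (nat \<Rightarrow> real \<times> real \<Rightarrow> real) \<Rightarrow> nat \<Rightarrow> real \<Rightarrow> real" where
  "outgoing_trace m v k t = v k (1 - bdry m k, t)"

text \<open>This is \<open>C_op\<close> with the boundary values of v replaced by arbitrary
  functions w of t, so that it also acts on trial traces that are not yet known to be
  periodic.\<close>

definition reflect ::
  "nat \<Rightarrow> nat \<Rightarrow> (nat \<Rightarrow> real \<times> real \<Rightarrow> real) \<Rightarrow> (nat \<Rightarrow> real \<times> real \<Rightarrow> real) \<Rightarrow>
   (nat \<Rightarrow> nat \<Rightarrow> real \<Rightarrow> real) \<Rightarrow>
   (nat \<Rightarrow> real \<Rightarrow> real) \<Rightarrow> (nat \<Rightarrow> real \<times> real \<Rightarrow> real)" where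
  "reflect n m a b p w = (\<lambda>j (x, t).
     if j \<in> {1..n} \<and> (x, t) \<in> strip then
       char_coeff (a j) (b j) (bdry m j) x t *
       (\<Sum>k=1..n. p j k (\<omega> (a j) (bdry m j) x t) * w k (\<omega> (a j) (bdry m j) x t))
     else 0)"

lemma C_op_eq_reflect: "C_op n m a b p v = reflect n m a b p (outgoing_trace m v)"
  unfolding C_op_def reflect_def outgoing_trace_def ..

locale reflection_system =
  fixes n m :: nat
    and a b :: "nat \<Rightarrow> real \<times> real \<Rightarrow> real"
    and p :: "nat \<Rightarrow> nat \<Rightarrow> real \<Rightarrow> real"
  assumes n_pos: "1 \<le> n"
    and a_C1: "j \<in> {1..n} \<Longrightarrow> a j \<in> C1_periodic"
    and b_C1: "j \<in> {1..n} \<Longrightarrow> b j \<in> C1_periodic"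
    and a_nonzero: "j \<in> {1..n} \<Longrightarrow> x \<in> {0..1} \<Longrightarrow> a j (x, t) \<noteq> 0"
    and p_periodic: "j \<in> {1..n} \<Longrightarrow> k \<in> {1..n} \<Longrightarrow> p j k \<in> C_periodic"
    and max_S_less: "max_S n m a b p < 1"
begin

lemma speed: "j \<in> {1..n} \<Longrightarrow> nonvanishing_speed (a j)"
  by unfold_locales (use a_C1 a_nonzero in auto)

lemma char_coeff_strip:
  "j \<in> {1..n} \<Longrightarrow> (\<lambda>(x, t). char_coeff (a j) (b j) (bdry m j) x t) \<in> C_periodic_strip"
  using nonvanishing_speed.char_coeff_mem[OF speed] b_C1 C1_periodic_subset bdry_mem by blast

lemma comp_omega_strip:
  "j \<in> {1..n} \<Longrightarrow> \<phi> \<in> C_periodic \<Longrightarrow> (\<lambda>(x, t). \<phi> (\<omega> (a j) (bdry m j) x t)) \<in> C_periodic_strip"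
  using nonvanishing_speed.C_periodic_comp_omega[OF speed] bdry_mem by blast

lemma reflect_in_C_space:
  assumes w: "\<And>k. k \<in> {1..n} \<Longrightarrow> w k \<in> C_periodic"
  shows "reflect n m a b p w \<in> C_space n"
proof -
  have "reflect n m a b p w j \<in> C_periodic_strip" if j: "j \<in> {1..n}" for j
  proof -
    have "(\<lambda>z. (\<lambda>(x, t). char_coeff (a j) (b j) (bdry m j) x t) z *
      (\<Sum>k\<in>{1..n}. (\<lambda>(x, t). p j k (\<omega> (a j) (bdry m j) x t)) z *
        (\<lambda>(x, t). w k (\<omega> (a j) (bdry m j) x t)) z)) \<in> C_periodic_strip"
      by (intro C_periodic_strip_mult C_periodic_strip_sum char_coeff_strip comp_omega_strip
          p_periodic w j)
    then show ?thesis
      by (rule C_periodic_strip_cong) (use j in \<open>auto simp: reflect_def strip_def\<close>)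
  qed
  then show ?thesis
    by (auto simp: C_space_def reflect_def strip_def)
qed

text \<open>Only continuity is asked of w, because the contraction runs over all bounded continuous
  traces; periodicity of its fixed point is shown afterwards.\<close>

lemma continuous_on_outgoing_reflect:
  assumes w: "\<And>k. k \<in> {1..n} \<Longrightarrow> continuous_on UNIV (w k)"
  shows "continuous_on UNIV (outgoing_trace m (reflect n m a b p w) j)"
proof (cases "j \<in> {1..n}")
  case True
  let ?x = "1 - bdry m j"
  have om: "continuous_on UNIV (\<lambda>t. \<omega> (a j) (bdry m j) ?x t)"
  proof -
    have "continuous_on UNIV (\<lambda>t. (?x, t))"
      by (intro continuous_intros)
    moreover have "(\<lambda>t. (?x, t)) ` UNIV \<subseteq> strip"
      using bdry_mem(2) by (auto simp: strip_def)
    ultimately show ?thesis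
      using continuous_on_compose2[OF nonvanishing_speed.continuous_on_omega[OF speed[OF True] bdry_mem(1)]]
      by fastforce
  qed
  have "continuous_on UNIV (\<lambda>t. char_coeff (a j) (b j) (bdry m j) ?x t)"
    using C_periodic_section[OF char_coeff_strip[OF True] bdry_mem(2)] by (simp add: C_periodic_def)
  moreover have "continuous_on UNIV (\<lambda>t. p j k (\<omega> (a j) (bdry m j) ?x t))" if "k \<in> {1..n}" for k
    using continuous_on_compose2[OF _ om, of UNIV "p j k"] p_periodic[OF True that]
    by (simp add: C_periodic_def)
  moreover have "continuous_on UNIV (\<lambda>t. w k (\<omega> (a j) (bdry m j) ?x t))" if "k \<in> {1..n}" for k
    using continuous_on_compose2[OF w[OF that] om] by simp
  ultimately have "continuous_on UNIV (\<lambda>t. char_coeff (a j) (b j) (bdry m j) ?x t *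
      (\<Sum>k=1..n. p j k (\<omega> (a j) (bdry m j) ?x t) * w k (\<omega> (a j) (bdry m j) ?x t)))"
    by (intro continuous_on_mult continuous_on_sum)
  then show ?thesis
    using True bdry_mem(2)[of m j] by (simp add: outgoing_trace_def[abs_def] reflect_def strip_def)
next
  case False
  then have "outgoing_trace m (reflect n m a b p w) j = (\<lambda>t. 0)"
    by (auto simp: fun_eq_iff outgoing_trace_def reflect_def)
  then show ?thesis
    by simp
qed

section \<open>The contraction estimate\<close>

lemma S_eq: "S n m a b p j t = char_coeff (a j) (b j) (bdry m j) (1 - bdry m j) t *
   (\<Sum>k=1..n. \<bar>p j k (\<omega> (a j) (bdry m j) (1 - bdry m j) t)\<bar>)"
  by (simp add: S_def bdry_def)

lemma S_nonneg: "0 \<le> S n m a b p j t"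
  unfolding S_eq by (intro mult_nonneg_nonneg sum_nonneg) (auto simp: char_coeff_def)

text \<open>A real supremum is an upper bound only for a set that is bounded above. Here boundedness
  comes from continuity and periodicity on the strip, evaluated at the end
  \<open>1 - bdry m j\<close>.\<close>

lemma S_le_max_S:
  assumes j: "j \<in> {1..n}"
  shows "S n m a b p j t \<le> max_S n m a b p"
proof -
  have "(\<lambda>t. \<bar>p j k t\<bar>) \<in> C_periodic" if "k \<in> {1..n}" for k
    using p_periodic[OF j that] by (auto simp: C_periodic_def intro: continuous_on_rabs)
  then have "(\<lambda>z. (\<lambda>(x, t). char_coeff (a j) (b j) (bdry m j) x t) z *
      (\<Sum>k\<in>{1..n}. (\<lambda>(x, t). \<bar>p j k (\<omega> (a j) (bdry m j) x t)\<bar>) z)) \<in> C_periodic_strip"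
    by (intro C_periodic_strip_mult C_periodic_strip_sum char_coeff_strip j comp_omega_strip[OF j, of "\<lambda>t. \<bar>p j _ t\<bar>"])
  then obtain M where "\<And>x t. x \<in> {0..1} \<Longrightarrow> \<bar>char_coeff (a j) (b j) (bdry m j) x t *
      (\<Sum>k\<in>{1..n}. \<bar>p j k (\<omega> (a j) (bdry m j) x t)\<bar>)\<bar> \<le> M"
    by (rule periodic_strip_bounded) auto
  from this[OF bdry_mem(2)[of m j]] have "\<bar>S n m a b p j t\<bar> \<le> M" for t
    by (simp only: S_eq)
  then have "bdd_above (range (S n m a b p j))"
    by (intro bdd_aboveI[of _ M]) (auto simp: abs_le_iff)
  then have "S n m a b p j t \<le> (SUP t. S n m a b p j t)"
    by (rule cSUP_upper[rotated]) simp
  also have "\<dots> \<le> max_S n m a b p"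
    unfolding max_S_def using j by (intro Max_ge) auto
  finally show ?thesis .
qed

lemma max_S_nonneg: "0 \<le> max_S n m a b p"
  using S_nonneg[of 1 0] S_le_max_S[of 1 0] n_pos by simp

text \<open>At the outgoing end, component j is a linear combination of the values of w whose
  absolute coefficients add up to \<open>S n m a b p j t\<close>. Components with index outside 1,
  ..., n vanish.\<close>

lemma outgoing_reflect_bound:
  assumes w: "\<And>k t. \<bar>w k t\<bar> \<le> B"
  shows "\<bar>outgoing_trace m (reflect n m a b p w) j t\<bar> \<le> max_S n m a b p * B"
proof -
  have B: "0 \<le> B"
    using w[of 0 0] by simp
  show ?thesis
  proof (cases "j \<in> {1..n}")
    case True
    let ?\<omega> = "\<omega> (a j) (bdry m j) (1 - bdry m j) t"
    let ?c = "char_coeff (a j) (b j) (bdry m j) (1 - bdry m j) t"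
    have c: "0 \<le> ?c"
      by (simp add: char_coeff_def)
    have "\<bar>outgoing_trace m (reflect n m a b p w) j t\<bar> = ?c * \<bar>\<Sum>k=1..n. p j k ?\<omega> * w k ?\<omega>\<bar>"
      using True bdry_mem(2)[of m j] c by (simp add: outgoing_trace_def reflect_def strip_def abs_mult)
    also have "\<dots> \<le> ?c * (\<Sum>k=1..n. \<bar>p j k ?\<omega>\<bar> * B)"
      using c w by (intro mult_left_mono order_trans[OF sum_abs] sum_mono)
        (auto simp: abs_mult intro!: mult_left_mono)
    also have "\<dots> = S n m a b p j t * B"
      by (simp add: S_eq sum_distrib_right)
    also have "\<dots> \<le> max_S n m a b p * B"
      using S_le_max_S[OF True] B by (rule mult_right_mono)
    finally show ?thesis .
  next
    case False
    then show ?thesis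
      using max_S_nonneg B by (auto simp: outgoing_trace_def reflect_def)
  qed
qed

lemma reflect_diff:
  "reflect n m a b p (\<lambda>k t. w k t - w' k t) j z = reflect n m a b p w j z - reflect n m a b p w' j z"
  by (auto simp: reflect_def right_diff_distrib sum_subtractf split: prod.splits)

text \<open>Raising t by 2 pi raises \<omega> by 2 pi and leaves the coefficients unchanged, so the
  shift passes to w.\<close>

lemma reflect_shift:
  assumes "x \<in> {0..1}"
  shows "reflect n m a b p w j (x, t + 2 * pi) = reflect n m a b p (\<lambda>k t. w k (t + 2 * pi)) j (x, t)"
proof (cases "j \<in> {1..n}")
  case True
  then show ?thesis
    using assms char_coeff_strip[OF True] p_periodic[OF True]
    by (auto simp: reflect_def strip_def C_periodic_strip_def periodic_in_t_def C_periodic_def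
        nonvanishing_speed.omega_add_period[OF speed[OF True] assms bdry_mem(1)])
qed (auto simp: reflect_def)

section \<open>The fixed-point equation for the outgoing traces\<close>

definition trace_step ::
  "(nat \<Rightarrow> real \<times> real \<Rightarrow> real) \<Rightarrow> (nat \<Rightarrow> real \<Rightarrow> real) \<Rightarrow> nat \<Rightarrow> real \<Rightarrow> real" where
  "trace_step g w j t = outgoing_trace m g j t + outgoing_trace m (reflect n m a b p w) j t"

lemma outgoing_trace_mem:
  assumes "g \<in> C_space n"
  shows "outgoing_trace m g j \<in> C_periodic"
proof (cases "j \<in> {1..n}")
  case True
  then show ?thesis
    using assms C_periodic_section[OF _ bdry_mem(2), of "g j"]
    by (simp add: C_space_def outgoing_trace_def[abs_def])
next
  case False
  with assms show ?thesis
    by (simp add: C_space_def outgoing_trace_def[abs_def] C_periodic_def)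
qed

lemma outgoing_trace_bounded:
  assumes "g \<in> C_space n"
  obtains M where "\<And>j t. \<bar>outgoing_trace m g j t\<bar> \<le> M"
proof -
  have "\<exists>M. \<forall>t. \<bar>outgoing_trace m g j t\<bar> \<le> M" if "j \<in> {1..n}" for j
  proof -
    have "g j \<in> C_periodic_strip"
      using assms that by (simp add: C_space_def)
    then obtain M where "M > 0" "\<And>x t. x \<in> {0..1} \<Longrightarrow> \<bar>g j (x, t)\<bar> \<le> M"
      using periodic_strip_bounded by metis
    then show ?thesis
      using bdry_mem(2) unfolding outgoing_trace_def by metis
  qed
  then obtain M where M: "\<And>j t. j \<in> {1..n} \<Longrightarrow> \<bar>outgoing_trace m g j t\<bar> \<le> M j"
    by metis
  show ?thesis
  proof (rule that)
    fix j t
    have nonneg: "0 \<le> M j" if "j \<in> {1..n}" for j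
      using M[OF that, of 0] by simp
    \<comment> \<open>The sum of the finitely many nonnegative component bounds serves as one bound
      for all indices; outside 1, ..., n the trace is zero.\<close>
    show "\<bar>outgoing_trace m g j t\<bar> \<le> (\<Sum>j\<in>{1..n}. M j)"
    proof (cases "j \<in> {1..n}")
      case True
      with M[OF True, of t] member_le_sum[of j "{1..n}" M] nonneg show ?thesis
        by fastforce
    next
      case False
      with assms nonneg show ?thesis
        by (auto simp: C_space_def outgoing_trace_def intro!: sum_nonneg)
    qed
  qed
qed

text \<open>\<open>Bcontfun\<close> returns the intended function only if that function is
  continuous and bounded. The bound is that of the trace of g plus \<open>max_S\<close> times the
  norm of w.\<close>

lemma component_trace_step:
  assumes g: "g \<in> C_space n"
  shows "component (Bcontfun (\<lambda>(j, t). trace_step g (component w) (of_discrete j) t)) j t =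
    trace_step g (component w) j t"
proof -
  obtain M where M: "\<And>j t. \<bar>outgoing_trace m g j t\<bar> \<le> M"
    using outgoing_trace_bounded[OF g] by metis
  have "continuous_on UNIV (trace_step g (component w) j)" for j
    unfolding trace_step_def[abs_def]
    using outgoing_trace_mem[OF g, of j] continuous_on_outgoing_reflect[OF continuous_on_component]
    by (intro continuous_on_add) (simp_all add: C_periodic_def)
  moreover have "\<bar>trace_step g (component w) j t\<bar> \<le> M + max_S n m a b p * norm w" for j t
    unfolding trace_step_def
    by (intro order_trans[OF abs_triangle_ineq] add_mono M outgoing_reflect_bound abs_component_le_norm)
  ultimately show ?thesis
    by (rule component_Bcontfun)
qed

lemma trace_step_unique_fixpoint:
  assumes g: "g \<in> C_space n"
  shows "\<exists>!w. \<forall>j t. trace_step g (component w) j t = component w j t"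
proof -
  define T where "T w = Bcontfun (\<lambda>(j, t). trace_step g (component w) (of_discrete j) t)" for w
  have T: "component (T w) j t = trace_step g (component w) j t" for w j t
    unfolding T_def by (rule component_trace_step[OF g])
  have "dist (T w) (T w') \<le> max_S n m a b p * dist w w'" for w w'
  proof (rule dist_bound)
    fix z :: "nat discrete \<times> real"
    define j t where "j = of_discrete (fst z)" and "t = snd z"
    have z: "z = (discrete j, t)"
      by (simp add: j_def t_def of_discrete_inverse)
    have "\<bar>component w k s - component w' k s\<bar> \<le> dist w w'" for k s
      using dist_bounded[of w "(discrete k, s)" w'] by (simp add: dist_real_def)
    \<comment> \<open>The term with g cancels in the difference of two steps, and by linearity the
      rest is the reflection of w - w'.\<close>
    then have "\<bar>outgoing_trace m (reflect n m a b p
        (\<lambda>k s. component w k s - component w' k s)) j t\<bar> \<le> max_S n m a b p * dist w w'"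
      by (rule outgoing_reflect_bound)
    then show "dist (apply_bcontfun (T w) z) (apply_bcontfun (T w') z) \<le> max_S n m a b p * dist w w'"
      by (simp add: z T trace_step_def outgoing_trace_def reflect_diff dist_real_def)
  qed
  then have "\<exists>!w. T w = w"
    using banach_fix_type[of "max_S n m a b p" T] max_S_nonneg max_S_less by simp
  moreover have "T w = w \<longleftrightarrow>
    (\<forall>j t. trace_step g (component w) j t = component w j t)" for w
  proof
    show "T w = w" if "\<forall>j t. trace_step g (component w) j t = component w j t"
      using that by (intro component_eqI) (simp add: T)
    show "\<forall>j t. trace_step g (component w) j t = component w j t" if "T w = w"
    proof (intro allI)
      fix j t
      show "trace_step g (component w) j t = component w j t"
        using T[of w j t] unfolding that by (rule sym)
    qed
  qed
  ultimately show ?thesis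
    by simp
qed

text \<open>Periodicity is not built into the space of trial traces; it is recovered by comparing w
  with its shift \<open>w'\<close> through uniqueness of the fixed point.\<close>

lemma trace_fixpoint_periodic:
  assumes g: "g \<in> C_space n"
    and fixpoint: "\<forall>j t. trace_step g (component w) j t = component w j t"
  shows "component w j \<in> C_periodic"
proof -
  define w' where "w' = Bcontfun (\<lambda>(j, t). component w (of_discrete j) (t + 2 * pi))"
  have "continuous_on UNIV (\<lambda>t. component w k (t + 2 * pi))" for k
    by (rule continuous_on_compose2[OF continuous_on_component]) (auto intro!: continuous_intros)
  then have w': "component w' k t = component w k (t + 2 * pi)" for k t
    unfolding w'_def by (rule component_Bcontfun) (rule abs_component_le_norm)
  have "trace_step g (component w') j t = component w' j t" for j t
  proof -
    have "outgoing_trace m (reflect n m a b p (component w')) j t =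
        outgoing_trace m (reflect n m a b p (component w)) j (t + 2 * pi)"
      unfolding outgoing_trace_def w' by (rule reflect_shift[OF bdry_mem(2), symmetric])
    moreover have "outgoing_trace m g j t = outgoing_trace m g j (t + 2 * pi)"
      using outgoing_trace_mem[OF g, of j] by (simp add: C_periodic_def)
    ultimately show ?thesis
      using fixpoint by (simp add: trace_step_def w')
  qed
  then have "w' = w"
    using trace_step_unique_fixpoint[OF g] fixpoint by blast
  then have "component w j (t + 2 * pi) = component w j t" for t
    using w' by metis
  with continuous_on_component show ?thesis
    by (simp add: C_periodic_def)
qed

section \<open>From traces back to functions on the strip\<close>

lemma C_op_in_C_space: "u \<in> C_space n \<Longrightarrow> C_op n m a b p u \<in> C_space n"
  unfolding C_op_eq_reflect by (intro reflect_in_C_space outgoing_trace_mem)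

text \<open>This is the equation u = Cu + g read at the outgoing ends, where Cu is the reflection of
  the trace of u itself.\<close>

lemma outgoing_trace_fixpoint:
  assumes u: "u \<in> C_space n" and g: "u - C_op n m a b p u = g"
  shows "trace_step g (outgoing_trace m u) j t = outgoing_trace m u j t"
  unfolding g[symmetric] by (simp add: trace_step_def C_op_eq_reflect) (simp add: outgoing_trace_def)

lemma outgoing_trace_as_component:
  assumes u: "u \<in> C_space n"
  obtains w where "component w = outgoing_trace m u"
proof -
  obtain M where "\<And>j t. \<bar>outgoing_trace m u j t\<bar> \<le> M"
    using outgoing_trace_bounded[OF u] by metis
  moreover have "continuous_on UNIV (outgoing_trace m u j)" for j
    using outgoing_trace_mem[OF u] by (simp add: C_periodic_def)
  ultimately have "component (Bcontfun (\<lambda>(j, t). outgoing_trace m u (of_discrete j) t)) = outgoing_trace m u"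
    by (intro ext component_Bcontfun)
  then show ?thesis
    by (rule that)
qed

lemma unique_solution:
  assumes g: "g \<in> C_space n"
  shows "\<exists>!u. u \<in> C_space n \<and> u - C_op n m a b p u = g"
proof (rule ex_ex1I)
  obtain w
    where w: "\<forall>j t. trace_step g (component w) j t = component w j t"
    using trace_step_unique_fixpoint[OF g] by blast
  define v where "v = component w"
  define u where "u = (\<lambda>j z. g j z + reflect n m a b p v j z)"
  have "u \<in> C_space n"
    unfolding u_def v_def
    by (intro C_space_add g reflect_in_C_space trace_fixpoint_periodic[OF g w])
  \<comment> \<open>The trace of u is one step applied to v, which is v again. Therefore the
    reflection of v in the definition of u is Cu.\<close>
  moreover have "outgoing_trace m u = v"
    using w by (simp add: fun_eq_iff outgoing_trace_def u_def v_def trace_step_def)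
  then have "u - C_op n m a b p u = g"
    by (simp add: C_op_eq_reflect) (simp add: u_def fun_eq_iff)
  ultimately show "\<exists>u. u \<in> C_space n \<and> u - C_op n m a b p u = g"
    by blast
next
  fix u u'
  assume u: "u \<in> C_space n \<and> u - C_op n m a b p u = g"
    and u': "u' \<in> C_space n \<and> u' - C_op n m a b p u' = g"
  obtain w where w: "component w = outgoing_trace m u"
    using outgoing_trace_as_component u by metis
  obtain w' where w': "component w' = outgoing_trace m u'"
    using outgoing_trace_as_component u' by metis
  have "\<forall>j t. trace_step g (component w) j t = component w j t"
    unfolding w using outgoing_trace_fixpoint u fun_cong[OF fun_cong[OF w]] by simp
  moreover have "\<forall>j t. trace_step g (component w') j t = component w' j t"
    unfolding w' using outgoing_trace_fixpoint u' fun_cong[OF fun_cong[OF w']] by simp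
  ultimately have "w = w'"
    using trace_step_unique_fixpoint[OF g] by blast
  \<comment> \<open>Equal traces give Cu = Cu', and then both solutions equal g + Cu.\<close>
  with w w' have "C_op n m a b p u = C_op n m a b p u'"
    by (simp add: C_op_eq_reflect)
  with u u' have "u - C_op n m a b p u' = u' - C_op n m a b p u'"
    by simp
  then show "u = u'"
    by (simp add: fun_eq_iff)
qed

lemma C_op_zero: "C_op n m a b p (\<lambda>j z. 0) = (\<lambda>j z. 0)"
  by (auto simp: C_op_def fun_eq_iff)

end

theorem mainTheorem3:
  fixes n m :: nat
    and a b :: "nat \<Rightarrow> real \<times> real \<Rightarrow> real"
    and p :: "nat \<Rightarrow> nat \<Rightarrow> real \<Rightarrow> real"
  assumes "1 \<le> n" and "m \<le> n"
    and "\<And>j. j \<in> {1..n} \<Longrightarrow> a j \<in> C1_periodic"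
    and "\<And>j. j \<in> {1..n} \<Longrightarrow> b j \<in> C1_periodic"
    and "\<And>j x t. j \<in> {1..n} \<Longrightarrow> x \<in> {0..1} \<Longrightarrow> a j (x, t) \<noteq> 0"
    and "\<And>j k. j \<in> {1..n} \<Longrightarrow> k \<in> {1..n} \<Longrightarrow> p j k \<in> C_periodic"
    and "max_S n m a b p < 1"
  shows "bij_betw (\<lambda>u. u - C_op n m a b p u) (C_space n) (C_space n) \<and>
         {u \<in> C_space n. u = C_op n m a b p u} = {\<lambda>j z. 0}"
proof -
  interpret reflection_system n m a b p
    using assms by unfold_locales auto
  let ?I = "\<lambda>u. u - C_op n m a b p u"
  have closed: "?I u \<in> C_space n" if "u \<in> C_space n" for u
    using that by (intro C_space_diff C_op_in_C_space)
  have bij: "bij_betw ?I (C_space n) (C_space n)"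
    unfolding bij_betw_def
  proof
    show "inj_on ?I (C_space n)"
      using unique_solution closed by (intro inj_onI) blast
    show "?I ` C_space n = C_space n"
      using unique_solution closed by blast
  qed
  have zero: "(\<lambda>j z. 0) \<in> C_space n"
    by (simp add: C_space_def C_periodic_strip_def periodic_in_t_def)
  have "u = (\<lambda>j z. 0)" if "u \<in> C_space n" "u = C_op n m a b p u" for u
  proof -
    \<comment> \<open>Both sides are the zero function, so injectivity of I - C forces u =
      0.\<close>
    have "?I u = ?I (\<lambda>j z. 0)"
      using that(2) by (simp add: C_op_zero fun_eq_iff)
    then show ?thesis
      using bij that(1) zero by (auto simp: bij_betw_def dest: inj_onD)
  qed
  then have "{u \<in> C_space n. u = C_op n m a b p u} \<subseteq> {\<lambda>j z. 0}"
    by blast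
  moreover have "{\<lambda>j z. 0} \<subseteq> {u \<in> C_space n. u = C_op n m a b p u}"
    using zero C_op_zero[symmetric] by blast
  ultimately have "{u \<in> C_space n. u = C_op n m a b p u} = {\<lambda>j z. 0}"
    by (rule equalityI)
  with bij show ?thesis
    by blast
qed

end
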